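(* Let $(Y_n,\Gamma_n)_{n\in\mathbb{N}_0}$, $Y_n=(X_n,\phi_n)$, be an AIR MCMC chain with parameter $\beta\ge1$ in the setting described in the context. Assume that there exist $\tau\in[0,1)$ and $\Lambda\in(0,\infty)$ such that for all $\gamma\in\mathcal{I}$, $y\in\mathcal{Y}$ and $\ell\in\mathbb{N}$, $$\|P_\gamma^\ell(y,\cdot)-\pi_\gamma\|_{tv}\le\Lambda\tau^\ell .$$ Let $f\colon\mathcal{X}\to\mathbb{R}$ be measurable and bounded. Then for every $\varepsilon>0$, almost surely, $$\lim_{n\to\infty}\frac{1}{\sqrt n\,(\log n)^{1/2+\varepsilon}}\sum_{j=1}^n\bigl(f(X_j)-\nu(f)\bigr)=0 .$$
   Context: Setting. $(\mathcal{X},\mathcal{F}_\mathcal{X},\nu)$ is a probability space, $(\Phi,\mathcal{F}_\Phi)$ is a measurable space, and $\mathcal{Y}=\mathcal{X}\times\Phi$ with $\mathcal{F}_\mathcal{Y}=\mathcal{F}_\mathcal{X}\otimes\mathcal{F}_\Phi$; these are Polish spaces with their (countably generated) Borel $\sigma$-algebras. $(\mathcal{I},\mathcal{F}_\mathcal{I})$ is a measurable space. $\{\pi_\gamma\}_{\gamma\in\mathcal{I}}$ is a family of probability measures on $\mathcal{Y}$ and $\{P_\gamma\}_{\gamma\in\mathcal{I}}$ a family of transition kernels on $\mathcal{Y}$ such that for every $\gamma$: $\pi_\gamma(B\times\Phi)=\nu(B)$ for all $B\in\mathcal{F}_\mathcal{X}$; $\pi_\gamma$ is the invariant distribution of $P_\gamma$;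 $P_\gamma$ is $\psi$-irreducible and aperiodic. Moreover $(y,\gamma)\mapsto P_\gamma(y,A)$ is measurable for every $A\in\mathcal{F}_\mathcal{Y}$. Write $\nu(f)=\int f\,d\nu$. AIR MCMC chain with parameter $\beta>0$. Put $k_j=\lceil j^\beta\rceil$, $T_0=0$, $T_m=\sum_{j=1}^m k_j$. The chain is a process $(Y_n,\Gamma_n)_{n\in\mathbb{N}_0}$ on a probability space $(\Omega,\mathcal{F},\mathbb{P})$ with values in $\mathcal{Y}\times\mathcal{I}$ such that: $(Y_0,\Gamma_0)=(y_0,\gamma_0)$ is deterministic; with $\mathcal{F}_n=\sigma(Y_0,\dots,Y_n,\Gamma_0,\dots,\Gamma_n)$ one has $\mathbb{P}[Y_{n+1}\in B\mid\mathcal{F}_n]=P_{\Gamma_n}(Y_n,B)$ a.s. for all $B\in\mathcal{F}_\mathcal{Y}$; $\Gamma_n=U_n(Y_0,\dots,Y_n,\Gamma_0,\dots,\Gamma_{n-1})$ for measurable maps $U_n\colon\mathcal{Y}^{n+1}\times\mathcal{I}^n\to\mathcal{I}$; adaptation happens only at the times $T_m$, i.e. $\Gamma_{i_1}=\Gamma_{i_2}$ whenever $i_1,i_2\in\{T_j,\dots,T_{j+1}-1\}$ for some $j$; and $\omega\mapsto\pi_{\Gamma_n(\omega)}(g)$ is measurable for every measurable $g\colon\mathcal{Y}\to\mathbb{R}$ with $\pi_\gamma(|g|)<\infty$ for all $\gamma$. Write $Y_n=(X_n,\phi_n)$ with $X_n\in\mathcal{X}$, $\phi_n\in\Phi$.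 Total variation distance: $\|\mu_1-\mu_2\|_{tv}=\inf_\xi\int\mathds{1}_{\{x\neq y\}}\,\xi(dx,dy)=\sup_{A\in\mathcal{F}_\mathcal{Y}}|\mu_1(A)-\mu_2(A)|$, the infimum being over all couplings $\xi$ of $\mu_1,\mu_2$. *)

theory Defs
  imports "HOL-Probability.Probability"
begin

text \<open>A Markov kernel on \<open>S\<close> is an element of \<open>S \<rightarrow>\<^sub>M prob_algebra S\<close>; its iterates are
  formed in the Giry monad, i.e. by the Chapman--Kolmogorov equation
  \<open>P^(n+1)(y, A) = \<integral> P^n(z, A) P(y, dz)\<close>.\<close>

primrec kernel_pow :: "'y measure \<Rightarrow> ('y \<Rightarrow> 'y measure) \<Rightarrow> nat \<Rightarrow> 'y \<Rightarrow> 'y measure" where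
  "kernel_pow S K 0 y = return S y"
| "kernel_pow S K (Suc n) y = K y \<bind> kernel_pow S K n"

definition tv_dist :: "'y measure \<Rightarrow> 'y measure \<Rightarrow> 'y measure \<Rightarrow> real" where
  "tv_dist S \<mu>1 \<mu>2 = (SUP A\<in>sets S. \<bar>measure \<mu>1 A - measure \<mu>2 A\<bar>)"

definition invariant_distribution :: "'y measure \<Rightarrow> ('y \<Rightarrow> 'y measure) \<Rightarrow> bool" where
  "invariant_distribution \<mu> K \<longleftrightarrow> \<mu> \<bind> K = \<mu>"

text \<open>Irreducibility and aperiodicity are those of Meyn and Tweedie, \<^emph>\<open>Markov Chains and Stochastic
  Stability\<close>, Sections 4.2 and 5.4: \<open>\<psi>\<close> is a maximal irreducibility measure, and the period is
  the largest \<open>d\<close> for which a \<open>d\<close>-cycle exists.\<close>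

definition irreducibility_measure ::
    "'y measure \<Rightarrow> ('y \<Rightarrow> 'y measure) \<Rightarrow> 'y measure \<Rightarrow> bool" where
  "irreducibility_measure S K \<phi> \<longleftrightarrow>
     sigma_finite_measure \<phi> \<and> sets \<phi> = sets S \<and> emeasure \<phi> (space S) > 0 \<and>
     (\<forall>A\<in>sets S. emeasure \<phi> A > 0 \<longrightarrow>
        (\<forall>y\<in>space S. \<exists>n\<ge>1. emeasure (kernel_pow S K n y) A > 0))"

definition psi_irreducible :: "'y measure \<Rightarrow> ('y \<Rightarrow> 'y measure) \<Rightarrow> 'y measure \<Rightarrow> bool" where
  "psi_irreducible S K \<psi> \<longleftrightarrow>
     irreducibility_measure S K \<psi> \<and>
     (\<forall>\<phi>. irreducibility_measure S K \<phi> \<longrightarrow> absolutely_continuous \<psi> \<phi>)"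

definition kernel_cycle ::
    "'y measure \<Rightarrow> ('y \<Rightarrow> 'y measure) \<Rightarrow> 'y measure \<Rightarrow> nat \<Rightarrow> (nat \<Rightarrow> 'y set) \<Rightarrow> bool" where
  "kernel_cycle S K \<psi> d D \<longleftrightarrow>
     d \<ge> 1 \<and> (\<forall>i<d. D i \<in> sets S) \<and> disjoint_family_on D {..<d} \<and>
     (\<forall>i<d. \<forall>y\<in>D i. emeasure (K y) (D (Suc i mod d)) = 1) \<and>
     space S - (\<Union>i<d. D i) \<in> null_sets \<psi>"

definition aperiodic_kernel :: "'y measure \<Rightarrow> ('y \<Rightarrow> 'y measure) \<Rightarrow> 'y measure \<Rightarrow> bool" where
  "aperiodic_kernel S K \<psi> \<longleftrightarrow> (\<forall>d D. kernel_cycle S K \<psi> d D \<longrightarrow> d = 1)"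

abbreviation state_space :: "('x::polish_space \<times> 'p::polish_space) measure" where
  "state_space \<equiv> borel \<Otimes>\<^sub>M borel"

locale adaptive_mcmc_setting =
  fixes I :: "'i measure"
    and \<nu> :: "'x::polish_space measure"
    and \<pi> :: "'i \<Rightarrow> ('x \<times> 'p::polish_space) measure"
    and P :: "'i \<Rightarrow> 'x \<times> 'p \<Rightarrow> ('x \<times> 'p) measure"
  assumes nu_prob: "\<nu> \<in> space (prob_algebra borel)"
    and pi_prob: "\<And>\<gamma>. \<gamma> \<in> space I \<Longrightarrow> \<pi> \<gamma> \<in> space (prob_algebra state_space)"
    and kernel: "\<And>\<gamma>. \<gamma> \<in> space I \<Longrightarrow> P \<gamma> \<in> state_space \<rightarrow>\<^sub>M prob_algebra state_space"
    and marginal: "\<And>\<gamma> B. \<gamma> \<in> space I \<Longrightarrow> B \<in> sets borel \<Longrightarrow>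
                     emeasure (\<pi> \<gamma>) (B \<times> UNIV) = emeasure \<nu> B"
    and invariant: "\<And>\<gamma>. \<gamma> \<in> space I \<Longrightarrow> invariant_distribution (\<pi> \<gamma>) (P \<gamma>)"
    and irreducible_aperiodic: "\<And>\<gamma>. \<gamma> \<in> space I \<Longrightarrow>
          \<exists>\<psi>. psi_irreducible state_space (P \<gamma>) \<psi> \<and> aperiodic_kernel state_space (P \<gamma>) \<psi>"
    and joint_measurable: "\<And>A. A \<in> sets state_space \<Longrightarrow>
          (\<lambda>(y, \<gamma>). measure (P \<gamma> y) A) \<in> borel_measurable (state_space \<Otimes>\<^sub>M I)"

definition air_lag :: "real \<Rightarrow> nat \<Rightarrow> nat" where
  "air_lag \<beta> j = nat \<lceil>real j powr \<beta>\<rceil>"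

definition air_time :: "real \<Rightarrow> nat \<Rightarrow> nat" where
  "air_time \<beta> m = (\<Sum>j=1..m. air_lag \<beta> j)"

definition history_algebra ::
    "'w measure \<Rightarrow> 'y measure \<Rightarrow> 'i measure \<Rightarrow> (nat \<Rightarrow> 'w \<Rightarrow> 'y) \<Rightarrow> (nat \<Rightarrow> 'w \<Rightarrow> 'i) \<Rightarrow>
     nat \<Rightarrow> 'w measure" where
  "history_algebra M S I Y \<Gamma> n = sigma (space M)
     (\<Union>i\<le>n. {Y i -` A \<inter> space M | A. A \<in> sets S} \<union> {\<Gamma> i -` B \<inter> space M | B. B \<in> sets I})"

locale air_mcmc_chain = adaptive_mcmc_setting I \<nu> \<pi> P + prob_space M
  for I :: "'i measure"
    and \<nu> :: "'x::polish_space measure"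
    and \<pi> :: "'i \<Rightarrow> ('x \<times> 'p::polish_space) measure"
    and P :: "'i \<Rightarrow> 'x \<times> 'p \<Rightarrow> ('x \<times> 'p) measure"
    and M :: "'w measure" +
  fixes \<beta> :: real
    and y0 :: "'x \<times> 'p"
    and \<gamma>0 :: 'i
    and Y :: "nat \<Rightarrow> 'w \<Rightarrow> 'x \<times> 'p"
    and \<Gamma> :: "nat \<Rightarrow> 'w \<Rightarrow> 'i"
  assumes beta_pos: "\<beta> > 0"
    and Y_measurable: "\<And>n. Y n \<in> M \<rightarrow>\<^sub>M state_space"
    and Gamma_measurable: "\<And>n. \<Gamma> n \<in> M \<rightarrow>\<^sub>M I"
    and initial: "\<And>\<omega>. \<omega> \<in> space M \<Longrightarrow> Y 0 \<omega> = y0 \<and> \<Gamma> 0 \<omega> = \<gamma>0"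
    and transition: "\<And>n B. B \<in> sets state_space \<Longrightarrow>
          AE \<omega> in M. real_cond_exp M (history_algebra M state_space I Y \<Gamma> n)
                       (indicator (Y (Suc n) -` B \<inter> space M)) \<omega>
                     = measure (P (\<Gamma> n \<omega>) (Y n \<omega>)) B"
    and adaptation: "\<And>n. \<exists>U \<in> (\<Pi>\<^sub>M i\<in>{..n}. state_space) \<Otimes>\<^sub>M (\<Pi>\<^sub>M i\<in>{..<n}. I) \<rightarrow>\<^sub>M I.
          \<forall>\<omega>\<in>space M. \<Gamma> n \<omega> = U (\<lambda>i\<in>{..n}. Y i \<omega>, \<lambda>i\<in>{..<n}. \<Gamma> i \<omega>)"
    and adaptation_times: "\<And>j i1 i2 \<omega>.
          i1 \<in> {air_time \<beta> j..<air_time \<beta> (Suc j)} \<Longrightarrow>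
          i2 \<in> {air_time \<beta> j..<air_time \<beta> (Suc j)} \<Longrightarrow>
          \<omega> \<in> space M \<Longrightarrow> \<Gamma> i1 \<omega> = \<Gamma> i2 \<omega>"
    and pi_Gamma_measurable: "\<And>n (g :: 'x \<times> 'p \<Rightarrow> real).
          g \<in> borel_measurable state_space \<Longrightarrow>
          (\<And>\<gamma>. \<gamma> \<in> space I \<Longrightarrow> integrable (\<pi> \<gamma>) g) \<Longrightarrow>
          (\<lambda>\<omega>. \<integral>y. g y \<partial>\<pi> (\<Gamma> n \<omega>)) \<in> borel_measurable M"

end

theory Submission
  imports Defs "HOL-Real_Asymp.Real_Asymp"
begin

text \<open>Uniform ergodicity makes the Neumann series \<open>u\<^sub>\<gamma> = \<Sum>l. P\<^sub>\<gamma>^l g\<close>, with \<open>g = f - \<nu>(f)\<close>, converge to a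
  solution of the Poisson equation \<open>u\<^sub>\<gamma> - P\<^sub>\<gamma> u\<^sub>\<gamma> = g\<close> that is bounded uniformly in \<open>\<gamma>\<close>. Hence the partial
  sums of \<open>g(Y\<^sub>j)\<close> are a martingale with bounded increments plus a remainder that telescopes as long
  as the parameter does not change. As \<open>\<beta> \<ge> 1\<close>, there are only \<open>O(sqrt n)\<close> parameter changes up to time
  \<open>n\<close>, so the remainder is negligible for every path. The martingale is handled by Azuma's inequality and
  the Borel--Cantelli lemma, since \<open>exp (- c (ln n) powr (1 + 2 \<epsilon>))\<close> is summable.\<close>

subsection \<open>Martingales with bounded increments\<close>

text \<open>On [-1, 1] this follows from \<open>exp x \<le> 1 + x + x^2\<close> and
  \<open>1 + x^2 \<le> exp (x^2)\<close>. For \<open>x > 1\<close> the exponent \<open>x^2\<close>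
  already exceeds \<open>x\<close>, and for \<open>x < -1\<close> the left side is below 1 while
  \<open>x + x^2\<close> is nonnegative. The gain over a cruder bound is the exactly linear term,
  which a martingale increment integrates to zero.\<close>

lemma exp_le_add_exp_square: "exp x \<le> x + exp (x\<^sup>2)" for x :: real
proof -
  have sq: "1 + x\<^sup>2 \<le> exp (x\<^sup>2)"
    by (rule exp_ge_add_one_self)
  consider "x > 1" | "0 \<le> x" "x \<le> 1" | "-1 \<le> x" "x < 0" | "x < -1"
    by linarith
  then show ?thesis
  proof cases
    case 1
    then have "exp x \<le> exp (x\<^sup>2)"
      by (simp add: power2_eq_square)
    with 1 show ?thesis by linarith
  next
    case 2
    then show ?thesis using exp_bound[of x] sq by linarith
  next
    case 3
    define y where "y = - x"
    have y: "0 \<le> y" "y \<le> 1"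
      using 3 by (auto simp: y_def)
    \<comment> \<open>The second factor on the right is the quadratic Taylor polynomial of
      \<open>exp y\<close>. The linear terms of the product cancel, so it is at least 1, and
      dividing by \<open>exp y\<close> gives \<open>exp (- y) \<le> 1 - y + y^2\<close>.\<close>
    have "1 + y\<^sup>2 / 2 + y^3 / 2 + y^4 / 2 = (1 - y + y\<^sup>2) * (1 + y + y\<^sup>2 / 2)"
      by (simp add: field_simps power2_eq_square power3_eq_cube power4_eq_xxxx)
    also have "\<dots> \<le> (1 - y + y\<^sup>2) * exp y"
      using y by (intro mult_left_mono exp_lower_Taylor_quadratic) auto
    finally have "1 \<le> (1 - y + y\<^sup>2) * exp y"
      using y by (smt (verit) divide_nonneg_pos zero_le_power)
    then have "exp x \<le> 1 + x + x\<^sup>2"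
      by (simp add: y_def exp_minus field_simps)
    with sq show ?thesis by linarith
  next
    case 4
    then have "exp x < 1" by simp
    moreover have "0 \<le> x + x\<^sup>2"
      using 4 mult_nonneg_nonneg[of "-x" "- 1 - x"] by (simp add: power2_eq_square algebra_simps)
    ultimately show ?thesis using sq by linarith
  qed
qed

context prob_space
begin

text \<open>Orthogonality of each increment to the exponentials of the preceding partial sums is the only
  part of the martingale property that the Chernoff argument uses.\<close>

lemma azuma_exponential_moment:
  fixes D :: "nat \<Rightarrow> 'a \<Rightarrow> real"
  assumes meas [measurable]: "\<And>n. D n \<in> borel_measurable M"
    and bound: "\<And>n \<omega>. \<omega> \<in> space M \<Longrightarrow> \<bar>D n \<omega>\<bar> \<le> C"
    and orth: "\<And>n. expectation (\<lambda>\<omega>. exp (s * (\<Sum>i<n. D i \<omega>)) * D n \<omega>) = 0"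
  shows "expectation (\<lambda>\<omega>. exp (s * (\<Sum>i<n. D i \<omega>))) \<le> exp (real n * (s * C)\<^sup>2)"
proof (induction n)
  case 0
  then show ?case by (simp add: prob_space)
next
  case (Suc n)
  define W where "W = (\<lambda>\<omega>. exp (s * (\<Sum>i<n. D i \<omega>)))"
  have W [measurable]: "W \<in> borel_measurable M"
    unfolding W_def by measurable
  have sum_le: "\<bar>\<Sum>i<m. D i \<omega>\<bar> \<le> real m * C" if "\<omega> \<in> space M" for \<omega> m
    using sum_bounded_above[of "{..<m}" "\<lambda>i. \<bar>D i \<omega>\<bar>" C] bound[OF that]
    by (intro order.trans[OF sum_abs]) simp
  have exp_le: "exp (s * (\<Sum>i<m. D i \<omega>)) \<le> exp (\<bar>s\<bar> * (real m * C))" if "\<omega> \<in> space M" for \<omega> m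
  proof -
    have "s * (\<Sum>i<m. D i \<omega>) \<le> \<bar>s\<bar> * \<bar>\<Sum>i<m. D i \<omega>\<bar>"
      by (metis abs_ge_self abs_mult)
    also have "\<dots> \<le> \<bar>s\<bar> * (real m * C)"
      by (intro mult_left_mono sum_le that) simp
    finally show ?thesis by simp
  qed
  have intW: "integrable M W"
    by (rule integrable_const_bound[where B = "exp (\<bar>s\<bar> * (real n * C))"])
       (use exp_le[of _ n] in \<open>auto simp: W_def\<close>)
  have intS: "integrable M (\<lambda>\<omega>. exp (s * (\<Sum>i<Suc n. D i \<omega>)))"
    by (rule integrable_const_bound[where B = "exp (\<bar>s\<bar> * (real (Suc n) * C))"])
       (use exp_le[of _ "Suc n"] in auto)
  have intWD: "integrable M (\<lambda>\<omega>. W \<omega> * D n \<omega>)"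
  proof (rule integrable_const_bound[where B = "exp (\<bar>s\<bar> * (real n * C)) * C"], rule AE_I2)
    fix \<omega> assume "\<omega> \<in> space M"
    then show "norm (W \<omega> * D n \<omega>) \<le> exp (\<bar>s\<bar> * (real n * C)) * C"
      unfolding W_def real_norm_def abs_mult abs_exp_cancel by (intro mult_mono exp_le bound) auto
  qed simp
  \<comment> \<open>After multiplication by \<open>W\<close> and integration the linear term
    vanishes by \<open>orth\<close>, so each further increment costs only the factor
    \<open>exp ((s * C)^2)\<close>.\<close>
  have step: "exp (s * D n \<omega>) \<le> s * D n \<omega> + exp ((s * C)\<^sup>2)" if "\<omega> \<in> space M" for \<omega>
  proof -
    have "\<bar>s * D n \<omega>\<bar> \<le> \<bar>s * C\<bar>"
      using bound[OF that, of n] by (auto simp: abs_mult intro!: mult_left_mono)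
    then have "(s * D n \<omega>)\<^sup>2 \<le> (s * C)\<^sup>2"
      by (simp add: abs_le_square_iff)
    then show ?thesis
      using exp_le_add_exp_square[of "s * D n \<omega>"] by (smt (verit) exp_le_cancel_iff)
  qed
  have "expectation (\<lambda>\<omega>. exp (s * (\<Sum>i<Suc n. D i \<omega>)))
      \<le> expectation (\<lambda>\<omega>. s * (W \<omega> * D n \<omega>) + exp ((s * C)\<^sup>2) * W \<omega>)"
  proof (rule integral_mono)
    fix \<omega> assume "\<omega> \<in> space M"
    then have "W \<omega> * exp (s * D n \<omega>) \<le> W \<omega> * (s * D n \<omega> + exp ((s * C)\<^sup>2))"
      by (intro mult_left_mono step) (simp_all add: W_def)
    then show "exp (s * (\<Sum>i<Suc n. D i \<omega>)) \<le> s * (W \<omega> * D n \<omega>) + exp ((s * C)\<^sup>2) * W \<omega>"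
      by (simp add: W_def distrib_left exp_add algebra_simps)
  qed (use intS intW intWD in auto)
  also have "\<dots> = exp ((s * C)\<^sup>2) * expectation W"
    using intW intWD orth[of n] by (simp add: W_def)
  also have "\<dots> \<le> exp ((s * C)\<^sup>2) * exp (real n * (s * C)\<^sup>2)"
    using Suc.IH by (intro mult_left_mono) (simp_all add: W_def)
  also have "\<dots> = exp (real (Suc n) * (s * C)\<^sup>2)"
    by (simp add: exp_add[symmetric] algebra_simps)
  finally show ?case .
qed

text \<open>Chernoff's method: Markov's inequality for the exponential moment, with \<open>s\<close>
  optimised. The constant 4, in place of the 2 in Azuma's classical bound, reflects the elementary
  exponential inequality used above.\<close>

lemma azuma_upper_tail:
  fixes D :: "nat \<Rightarrow> 'a \<Rightarrow> real"
  assumes meas [measurable]: "\<And>n. D n \<in> borel_measurable M"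
    and bound: "\<And>n \<omega>. \<omega> \<in> space M \<Longrightarrow> \<bar>D n \<omega>\<bar> \<le> C"
    and orth: "\<And>s n. expectation (\<lambda>\<omega>. exp (s * (\<Sum>i<n. D i \<omega>)) * D n \<omega>) = 0"
    and "C > 0" "n > 0" "t > 0"
  shows "prob {\<omega> \<in> space M. (\<Sum>i<n. D i \<omega>) \<ge> t} \<le> exp (- (t\<^sup>2 / (4 * real n * C\<^sup>2)))"
proof -
  \<comment> \<open>This is the minimiser of the quadratic exponent
    \<open>n * (s * C)^2 - s * t\<close>.\<close>
  define s where "s = t / (2 * real n * C\<^sup>2)"
  have s: "s > 0" using assms by (simp add: s_def)
  have sum_le: "\<bar>\<Sum>i<n. D i \<omega>\<bar> \<le> real n * C" if "\<omega> \<in> space M" for \<omega>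
    using sum_bounded_above[of "{..<n}" "\<lambda>i. \<bar>D i \<omega>\<bar>" C] bound[OF that]
    by (intro order.trans[OF sum_abs]) simp
  have int: "integrable M (\<lambda>\<omega>. exp (s * (\<Sum>i<n. D i \<omega>)))"
    by (rule integrable_const_bound[where B = "exp (s * (real n * C))"])
       (use s sum_le in \<open>auto intro!: AE_I2 dest: abs_le_D1\<close>)
  have "{\<omega> \<in> space M. (\<Sum>i<n. D i \<omega>) \<ge> t} = {\<omega> \<in> space M. exp (s * (\<Sum>i<n. D i \<omega>)) \<ge> exp (s * t)}"
    using s by simp
  also have "prob \<dots> \<le> expectation (\<lambda>\<omega>. exp (s * (\<Sum>i<n. D i \<omega>))) / exp (s * t)"
    by (rule integral_Markov_inequality_measure[where A = "space M"]) (use int in auto)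
  also have "\<dots> \<le> exp (real n * (s * C)\<^sup>2) / exp (s * t)"
    by (intro divide_right_mono azuma_exponential_moment) (use bound orth in auto)
  also have "\<dots> = exp (real n * (s * C)\<^sup>2 - s * t)"
    by (simp add: exp_diff)
  also have "real n * (s * C)\<^sup>2 - s * t = - (t\<^sup>2 / (4 * real n * C\<^sup>2))"
    using assms by (simp add: s_def field_simps power2_eq_square)
  finally show ?thesis .
qed

lemma azuma_tail:
  fixes D :: "nat \<Rightarrow> 'a \<Rightarrow> real"
  assumes meas [measurable]: "\<And>n. D n \<in> borel_measurable M"
    and bound: "\<And>n \<omega>. \<omega> \<in> space M \<Longrightarrow> \<bar>D n \<omega>\<bar> \<le> C"
    and orth: "\<And>s n. expectation (\<lambda>\<omega>. exp (s * (\<Sum>i<n. D i \<omega>)) * D n \<omega>) = 0"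
    and pos: "C > 0" "n > 0" "t > 0"
  shows "prob {\<omega> \<in> space M. \<bar>\<Sum>i<n. D i \<omega>\<bar> \<ge> t} \<le> 2 * exp (- (t\<^sup>2 / (4 * real n * C\<^sup>2)))"
proof -
  have "{\<omega> \<in> space M. \<bar>\<Sum>i<n. D i \<omega>\<bar> \<ge> t}
      = {\<omega> \<in> space M. (\<Sum>i<n. D i \<omega>) \<ge> t} \<union> {\<omega> \<in> space M. (\<Sum>i<n. - D i \<omega>) \<ge> t}"
    by (auto simp: sum_negf)
  also have "prob \<dots> \<le> prob {\<omega> \<in> space M. (\<Sum>i<n. D i \<omega>) \<ge> t}
      + prob {\<omega> \<in> space M. (\<Sum>i<n. - D i \<omega>) \<ge> t}"
    by (intro measure_Un_le) measurable
  also have "\<dots> \<le> exp (- (t\<^sup>2 / (4 * real n * C\<^sup>2))) + exp (- (t\<^sup>2 / (4 * real n * C\<^sup>2)))"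
  proof (intro add_mono azuma_upper_tail meas bound orth pos)
    \<comment> \<open>Passing from \<open>D\<close> to \<open>- D\<close> amounts to changing the
      sign of \<open>s\<close>, which is why \<open>orth\<close> is assumed for every real
      \<open>s\<close>.\<close>
    show "expectation (\<lambda>\<omega>. exp (s * (\<Sum>i<n. - D i \<omega>)) * - D n \<omega>) = 0" for s n
      using orth[of "- s" n] by (simp add: sum_negf)
  qed (use bound in auto)
  finally show ?thesis by simp
qed

text \<open>For the threshold \<open>b n / (k + 1)\<close> the factor \<open>n\<close> in Azuma's
  exponent cancels, so the tail probabilities are summable over all \<open>n\<close> and
  Borel-Cantelli applies along the full sequence. Letting \<open>k\<close> run through the naturals
  gives convergence to 0.\<close>

lemma bounded_martingale_sum_growth:
  fixes D :: "nat \<Rightarrow> 'a \<Rightarrow> real"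
  assumes meas [measurable]: "\<And>n. D n \<in> borel_measurable M"
    and bound: "\<And>n \<omega>. \<omega> \<in> space M \<Longrightarrow> \<bar>D n \<omega>\<bar> \<le> C"
    and orth: "\<And>s n. expectation (\<lambda>\<omega>. exp (s * (\<Sum>i<n. D i \<omega>)) * D n \<omega>) = 0"
    and C: "C > 0" and e: "e > 0"
  shows "AE \<omega> in M. (\<lambda>n. 1 / (sqrt (real n) * ln (real n) powr (1 / 2 + e)) * (\<Sum>i<n. D i \<omega>)) \<longlonglongrightarrow> 0"
proof -
  define b where "b = (\<lambda>n. sqrt (real n) * ln (real n) powr (1 / 2 + e))"
  have b_pos: "b n > 0" if "n > 1" for n
    using that by (simp add: b_def)
  define A where "A = (\<lambda>k n. {\<omega> \<in> space M. \<bar>\<Sum>i<n. D i \<omega>\<bar> \<ge> b n / real (Suc k)})"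
  have A [measurable]: "A k n \<in> sets M" for k n
    unfolding A_def by measurable
  have "summable (\<lambda>n. prob (A k n))" for k
  proof (rule summable_comparison_test_ev)
    define d where "d = 1 / real (Suc k)"
    have d: "d > 0" by (simp add: d_def)
    \<comment> \<open>The exponent equals \<open>d^2 * (ln n) powr (1 + 2 * e) / (4 * C^2)\<close>
      up to sign. Since \<open>e > 0\<close>, it eventually exceeds \<open>2 * ln n\<close>.\<close>
    have "eventually (\<lambda>n. exp (- ((d * (sqrt (real n) * ln (real n) powr (1 / 2 + e)))\<^sup>2 / (4 * real n * C\<^sup>2)))
            \<le> 1 / real n ^ 2) sequentially"
      using d e C by real_asymp
    then show "eventually (\<lambda>n. norm (prob (A k n)) \<le> 2 * (1 / real n ^ 2)) sequentially"
      using eventually_gt_at_top[of 1]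
    proof eventually_elim
      case (elim n)
      have "prob (A k n) \<le> 2 * exp (- ((b n / real (Suc k))\<^sup>2 / (4 * real n * C\<^sup>2)))"
        unfolding A_def
        by (intro azuma_tail bound orth C) (use elim b_pos in auto)
      also have "\<dots> \<le> 2 * (1 / real n ^ 2)"
        using elim by (intro mult_left_mono) (simp_all add: b_def d_def)
      finally show ?case by simp
    qed
    show "summable (\<lambda>n. 2 * (1 / real n ^ 2))"
      using inverse_power_summable[of 2, where 'a = real]
      by (intro summable_mult) (simp add: inverse_eq_divide)
  qed
  then have "AE \<omega> in M. eventually (\<lambda>n. \<omega> \<in> space M - A k n) sequentially" for k
    by (intro borel_cantelli_AE1) (auto simp: less_top[symmetric])
  then have "AE \<omega> in M. \<forall>k. eventually (\<lambda>n. \<omega> \<in> space M - A k n) sequentially"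
    by (simp add: AE_all_countable)
  then show ?thesis
  proof eventually_elim
    case (elim \<omega>)
    show ?case
    proof (rule LIMSEQ_I)
      fix r :: real assume "r > 0"
      then obtain k where k: "1 / real (Suc k) < r"
        using nat_approx_posE by (metis of_nat_Suc)
      have "eventually (\<lambda>n. \<omega> \<in> space M - A k n) sequentially"
        using elim by blast
      then have "eventually (\<lambda>n. norm (1 / (sqrt (real n) * ln (real n) powr (1 / 2 + e)) * (\<Sum>i<n. D i \<omega>) - 0) < r)
                   sequentially"
        using eventually_gt_at_top[of 1]
      proof eventually_elim
        case (elim n)
        then have "\<bar>\<Sum>i<n. D i \<omega>\<bar> < b n / real (Suc k)"
          by (auto simp: A_def)
        then have "\<bar>\<Sum>i<n. D i \<omega>\<bar> / b n < 1 / real (Suc k)"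
          using b_pos[of n] elim by (simp add: field_simps)
        with k have "\<bar>\<Sum>i<n. D i \<omega>\<bar> / b n < r" by linarith
        then show ?case
          using elim by (simp add: b_def abs_mult)
      qed
      then show "\<exists>no. \<forall>n\<ge>no. norm (1 / (sqrt (real n) * ln (real n) powr (1 / 2 + e)) * (\<Sum>i<n. D i \<omega>) - 0) < r"
        by (simp add: eventually_sequentially)
    qed
  qed
qed

end

subsection \<open>Kernels and total variation\<close>

lemma integral_kernel_bind:
  fixes g :: "'b \<Rightarrow> real"
  assumes mu: "\<mu> \<in> space (prob_algebra S)" and K: "K \<in> S \<rightarrow>\<^sub>M prob_algebra R"
    and g: "g \<in> borel_measurable R" "\<And>y. y \<in> space R \<Longrightarrow> \<bar>g y\<bar> \<le> c"
  shows "(\<integral>y. g y \<partial>(\<mu> \<bind> K)) = (\<integral>z. (\<integral>y. g y \<partial>K z) \<partial>\<mu>)"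
proof (rule integral_bind[where K = R and B = c and B' = 1])
  have sets: "sets \<mu> = sets S" and "prob_space \<mu>"
    using mu by (auto simp: space_prob_algebra)
  then show "finite_measure \<mu>"
    by (simp add: prob_space.finite_measure)
  show "K \<in> \<mu> \<rightarrow>\<^sub>M subprob_algebra R"
    using K measurable_cong_sets[OF sets refl] by (blast intro: measurable_prob_algebraD)
  show "AE z in \<mu>. emeasure (K z) (space (K z)) \<le> ennreal 1"
  proof (rule AE_I2)
    fix z assume "z \<in> space \<mu>"
    then have "z \<in> space S" using sets_eq_imp_space_eq[OF sets] by simp
    then have "prob_space (K z)"
      using measurable_space[OF K] by (auto simp: space_prob_algebra)
    then show "emeasure (K z) (space (K z)) \<le> ennreal 1"
      by (simp add: prob_space.emeasure_space_1)
  qed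
qed (use g in auto)

text \<open>Measurability in the state and the parameter together is what allows the Poisson
  solution to be evaluated at the random pair \<open>(Y i, \<Gamma> j)\<close>.\<close>

lemma measurable_kernel_pow_joint:
  assumes K: "(\<lambda>(y, \<gamma>). P \<gamma> y) \<in> S \<Otimes>\<^sub>M I \<rightarrow>\<^sub>M prob_algebra S"
  shows "(\<lambda>(y, \<gamma>). kernel_pow S (P \<gamma>) n y) \<in> S \<Otimes>\<^sub>M I \<rightarrow>\<^sub>M prob_algebra S"
proof (induction n)
  case 0
  show ?case
    using measurable_compose[OF measurable_fst measurable_return_prob_space, of S I]
    by (simp add: case_prod_beta')
next
  case (Suc n)
  have "(\<lambda>x. P (snd x) (fst x) \<bind> kernel_pow S (P (snd x)) n) \<in> S \<Otimes>\<^sub>M I \<rightarrow>\<^sub>M prob_algebra S"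
  proof (rule measurable_bind_prob_space2)
    show "(\<lambda>x. P (snd x) (fst x)) \<in> S \<Otimes>\<^sub>M I \<rightarrow>\<^sub>M prob_algebra S"
      using K by (simp add: case_prod_beta')
    have "(\<lambda>p. (snd p, snd (fst p))) \<in> (S \<Otimes>\<^sub>M I) \<Otimes>\<^sub>M S \<rightarrow>\<^sub>M S \<Otimes>\<^sub>M I"
      by measurable
    from measurable_compose[OF this Suc.IH]
    show "(\<lambda>(x, z). kernel_pow S (P (snd x)) n z) \<in> (S \<Otimes>\<^sub>M I) \<Otimes>\<^sub>M S \<rightarrow>\<^sub>M prob_algebra S"
      by (simp add: case_prod_beta')
  qed
  then show ?case
    by (simp add: case_prod_beta')
qed

lemma measurable_kernel_pow:
  assumes K: "K \<in> S \<rightarrow>\<^sub>M prob_algebra S"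
  shows "kernel_pow S K n \<in> S \<rightarrow>\<^sub>M prob_algebra S"
proof (induction n)
  case 0
  have "kernel_pow S K 0 = return S" by (rule ext) simp
  then show ?case by simp
next
  case (Suc n)
  have "kernel_pow S K (Suc n) = (\<lambda>y. K y \<bind> kernel_pow S K n)" by (rule ext) simp
  then show ?case using measurable_bind_prob_space[OF K Suc.IH] by simp
qed

section \<open>Integrals of bounded functions and total variation\<close>

lemma measure_diff_le_tv_dist:
  assumes "\<mu>1 \<in> space (prob_algebra S)" "\<mu>2 \<in> space (prob_algebra S)" "A \<in> sets S"
  shows "\<bar>measure \<mu>1 A - measure \<mu>2 A\<bar> \<le> tv_dist S \<mu>1 \<mu>2"
  unfolding tv_dist_def
proof (rule cSUP_upper)
  interpret p1: prob_space \<mu>1 using assms by (simp add: space_prob_algebra)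
  interpret p2: prob_space \<mu>2 using assms by (simp add: space_prob_algebra)
  show "bdd_above ((\<lambda>A. \<bar>measure \<mu>1 A - measure \<mu>2 A\<bar>) ` sets S)"
  proof (rule bdd_aboveI2)
    show "\<bar>measure \<mu>1 A - measure \<mu>2 A\<bar> \<le> 1" for A
      using p1.prob_le_1[of A] p2.prob_le_1[of A] measure_nonneg[of \<mu>1 A] measure_nonneg[of \<mu>2 A]
      by linarith
  qed
qed fact

text \<open>The supremum in \<open>tv_dist\<close> sees only indicators, but \<open>n * h\<close> is
  a sum of \<open>n\<close> indicators up to an error of 1. Comparing the two measures set by set
  leaves an error of 2 that does not depend on \<open>n\<close>, and it disappears on division by
  \<open>n\<close>.\<close>

lemma integral_diff_le_tv_dist_01:
  fixes h :: "'a \<Rightarrow> real"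
  assumes mu: "\<mu>1 \<in> space (prob_algebra S)" "\<mu>2 \<in> space (prob_algebra S)"
    and h [measurable]: "h \<in> borel_measurable S"
    and h01: "\<And>z. z \<in> space S \<Longrightarrow> 0 \<le> h z \<and> h z \<le> 1"
  shows "\<bar>(\<integral>z. h z \<partial>\<mu>1) - (\<integral>z. h z \<partial>\<mu>2)\<bar> \<le> tv_dist S \<mu>1 \<mu>2"
proof -
  define d where "d = tv_dist S \<mu>1 \<mu>2"
  define A where "A = (\<lambda>n k. {z \<in> space S. real k \<le> real n * h z})"
  have A [measurable]: "A n k \<in> sets S" for n k
    unfolding A_def by measurable
  text \<open>Discretised layer-cake formula: \<open>n h\<close> is within 1 of the number of its integer
    superlevel sets containing the point.\<close>
  have approx: "\<bar>real n * (\<integral>z. h z \<partial>\<mu>) - (\<Sum>k=1..n. measure \<mu> (A n k))\<bar> \<le> 1"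
    if mu: "\<mu> \<in> space (prob_algebra S)" for \<mu> n
  proof -
    have sets [measurable_cong]: "sets \<mu> = sets S"
      using mu by (simp add: space_prob_algebra)
    have space: "space \<mu> = space S"
      using sets by (rule sets_eq_imp_space_eq)
    interpret prob_space \<mu> using mu by (simp add: space_prob_algebra)
    have int_h: "integrable \<mu> h"
      by (rule integrable_const_bound[where B = 1]) (use h01 in \<open>auto simp: space\<close>)
    have "\<bar>real n * h z - (\<Sum>k=1..n. indicator (A n k) z)\<bar> \<le> 1" if z: "z \<in> space \<mu>" for z
    proof -
      define x where "x = real n * h z"
      have x: "0 \<le> x" "x \<le> real n"
        using h01[of z] z by (auto simp: x_def space mult_left_le)
      have "(\<Sum>k=1..n. indicator (A n k) z) = (\<Sum>k=1..n. if real k \<le> x then 1 else 0 :: real)"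
        using z by (intro sum.cong) (auto simp: A_def space x_def)
      also have "\<dots> = real (card {k\<in>{1..n}. real k \<le> x})"
        by (simp add: sum.If_cases Int_def)
      \<comment> \<open>The levels start at 1, because level 0 would count every point; the number
        of levels reached is then the floor of \<open>x\<close>.\<close>
      also have "{k\<in>{1..n}. real k \<le> x} = {1..nat \<lfloor>x\<rfloor>}"
      proof -
        have "k \<le> nat \<lfloor>x\<rfloor> \<longleftrightarrow> real k \<le> x" for k
          using x by (simp add: le_nat_iff le_floor_iff)
        moreover have "k \<le> n" if "real k \<le> x" for k
          using that x by linarith
        ultimately show ?thesis by auto
      qed
      also have "real (card {1..nat \<lfloor>x\<rfloor>}) = of_int \<lfloor>x\<rfloor>"
        using x by simp
      finally show ?thesis
        unfolding x_def[symmetric] by linarith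
    qed
    then have "\<bar>\<integral>z. real n * h z - (\<Sum>k=1..n. indicator (A n k) z) \<partial>\<mu>\<bar> \<le> 1"
      using int_h by (intro order.trans[OF integral_abs_bound] integral_le_const)
        (auto intro!: Bochner_Integration.integrable_diff Bochner_Integration.integrable_sum simp: less_top[symmetric])
    moreover have "(\<integral>z. real n * h z - (\<Sum>k=1..n. indicator (A n k) z) \<partial>\<mu>)
        = real n * (\<integral>z. h z \<partial>\<mu>) - (\<Sum>k=1..n. measure \<mu> (A n k))"
      using int_h by (subst Bochner_Integration.integral_diff)
        (auto simp: less_top[symmetric] space sets.Int_space_eq2[OF A] intro!: Bochner_Integration.integrable_sum sum.cong)
    ultimately show ?thesis by simp
  qed
  define \<Delta> where "\<Delta> = \<bar>(\<integral>z. h z \<partial>\<mu>1) - (\<integral>z. h z \<partial>\<mu>2)\<bar>"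
  have key: "real n * (\<Delta> - d) \<le> 2" for n
  proof -
    have "\<bar>(\<Sum>k=1..n. measure \<mu>1 (A n k)) - (\<Sum>k=1..n. measure \<mu>2 (A n k))\<bar> \<le> real n * d"
      unfolding sum_subtractf[symmetric] d_def
      using sum_bounded_above[of "{1..n}" "\<lambda>k. \<bar>measure \<mu>1 (A n k) - measure \<mu>2 (A n k)\<bar>"]
        measure_diff_le_tv_dist[OF mu A]
      by (intro order.trans[OF sum_abs]) simp
    moreover have "real n * \<Delta> = \<bar>real n * (\<integral>z. h z \<partial>\<mu>1) - real n * (\<integral>z. h z \<partial>\<mu>2)\<bar>"
      unfolding \<Delta>_def right_diff_distrib[symmetric] abs_mult by simp
    ultimately have "real n * \<Delta> \<le> real n * d + 2"
      using approx[OF mu(1), of n] approx[OF mu(2), of n] by linarith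
    then show ?thesis by (simp add: algebra_simps)
  qed
  have "\<Delta> - d \<le> 0"
  proof (rule ccontr)
    assume "\<not> \<Delta> - d \<le> 0"
    then obtain n where "2 < real n * (\<Delta> - d)"
      using reals_Archimedean3[of "\<Delta> - d"] by auto
    with key[of n] show False by simp
  qed
  then show ?thesis by (simp add: \<Delta>_def d_def)
qed

text \<open>The affine map from [-c, c] onto [0, 1] reduces this to the previous lemma. Its additive
  part cancels between two probability measures, and its slope accounts for the factor
  \<open>2 * c\<close>.\<close>

lemma integral_diff_le_tv_dist:
  fixes g :: "'a \<Rightarrow> real"
  assumes mu: "\<mu>1 \<in> space (prob_algebra S)" "\<mu>2 \<in> space (prob_algebra S)"
    and g [measurable]: "g \<in> borel_measurable S" and bound: "\<And>z. z \<in> space S \<Longrightarrow> \<bar>g z\<bar> \<le> c"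
    and c: "c > 0"
  shows "\<bar>(\<integral>z. g z \<partial>\<mu>1) - (\<integral>z. g z \<partial>\<mu>2)\<bar> \<le> 2 * c * tv_dist S \<mu>1 \<mu>2"
proof -
  define h where "h = (\<lambda>z. (g z + c) / (2 * c))"
  have "(\<integral>z. h z \<partial>\<mu>) = ((\<integral>z. g z \<partial>\<mu>) + c) / (2 * c)" if mu: "\<mu> \<in> space (prob_algebra S)" for \<mu>
  proof -
    have sets [measurable_cong]: "sets \<mu> = sets S"
      using mu by (simp add: space_prob_algebra)
    interpret prob_space \<mu> using mu by (simp add: space_prob_algebra)
    have "integrable \<mu> g"
      by (rule integrable_const_bound[where B = c])
         (use bound sets_eq_imp_space_eq[OF sets] in auto)
    then show ?thesis by (simp add: h_def prob_space)
  qed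
  from this[OF mu(1)] this[OF mu(2)]
  have "\<bar>(\<integral>z. h z \<partial>\<mu>1) - (\<integral>z. h z \<partial>\<mu>2)\<bar> = \<bar>(\<integral>z. g z \<partial>\<mu>1) - (\<integral>z. g z \<partial>\<mu>2)\<bar> / (2 * c)"
    using c by (simp add: diff_divide_distrib[symmetric])
  moreover have "\<bar>(\<integral>z. h z \<partial>\<mu>1) - (\<integral>z. h z \<partial>\<mu>2)\<bar> \<le> tv_dist S \<mu>1 \<mu>2"
  proof (rule integral_diff_le_tv_dist_01[OF mu])
    show "h \<in> borel_measurable S" unfolding h_def by measurable
    show "0 \<le> h z \<and> h z \<le> 1" if "z \<in> space S" for z
      using bound[OF that] c by (auto simp: h_def)
  qed
  ultimately show ?thesis
    using c by (simp add: pos_divide_le_eq mult.commute)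
qed

section \<open>Integration against a conditional law\<close>

text \<open>The hypothesis \<open>cond\<close> treats one set at a time, with an exceptional null
  set depending on it. It nevertheless determines the joint law of the pair of
  \<open>\<omega>\<close> itself and \<open>X \<omega>\<close> on the product of \<open>F\<close>
  and \<open>S\<close>, since rectangles suffice for that. Keeping \<open>\<omega>\<close> as first
  coordinate lets \<open>H\<close> depend on everything that is \<open>F\<close>-measurable.\<close>

lemma (in prob_space) integral_regular_conditional_law:
  fixes H :: "'a \<times> 'b \<Rightarrow> real"
  assumes sub: "subalgebra M F" and Q: "Q \<in> F \<rightarrow>\<^sub>M prob_algebra S"
    and X [measurable]: "X \<in> M \<rightarrow>\<^sub>M S"
    and cond: "\<And>B. B \<in> sets S \<Longrightarrow>
      AE \<omega> in M. real_cond_exp M F (indicator (X -` B \<inter> space M)) \<omega> = measure (Q \<omega>) B"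
    and H: "H \<in> borel_measurable (F \<Otimes>\<^sub>M S)"
    and bound: "\<And>x. x \<in> space (F \<Otimes>\<^sub>M S) \<Longrightarrow> \<bar>H x\<bar> \<le> c"
  shows "(\<integral>\<omega>. H (\<omega>, X \<omega>) \<partial>M) = (\<integral>\<omega>. (\<integral>z. H (\<omega>, z) \<partial>Q \<omega>) \<partial>M)"
proof -
  interpret finite_measure_subalgebra M F
    by unfold_locales (rule sub)
  have spF: "space F = space M" and setsF: "sets F \<subseteq> sets M"
    using sub by (auto simp: subalgebra_def)
  define R where "R = F \<Otimes>\<^sub>M S"
  define N where "N = restr_to_subalg M F"
  \<comment> \<open>The measure \<open>\<kappa> \<omega>\<close> is the product of the point mass at
    \<open>\<omega>\<close> with \<open>Q \<omega>\<close>, so \<open>N \<bind> \<kappa>\<close> is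
    the candidate for the joint law.\<close>
  define \<kappa> where "\<kappa> = (\<lambda>\<omega>. Q \<omega> \<bind> (\<lambda>z. return R (\<omega>, z)))"
  have setsN: "sets N = sets F"
    unfolding N_def by (rule sets_restr_to_subalg[OF sub])
  have N: "N \<in> space (prob_algebra F)"
  proof -
    have "prob_space N"
      unfolding N_def by (rule prob_space_restr_to_subalg[OF sub prob_space_axioms])
    with setsN show ?thesis by (simp add: space_prob_algebra)
  qed
  have id_meas: "(\<lambda>\<omega>. \<omega>) \<in> M \<rightarrow>\<^sub>M F"
    using setsF spF by (auto intro!: measurableI)
  have pair [measurable]: "(\<lambda>\<omega>. (\<omega>, X \<omega>)) \<in> M \<rightarrow>\<^sub>M R"
    unfolding R_def using id_meas X by (rule measurable_Pair)
  have ret: "(\<lambda>z. return R (\<omega>, z)) \<in> S \<rightarrow>\<^sub>M prob_algebra R" if "\<omega> \<in> space F" for \<omega>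
    by (rule measurable_compose[OF _ measurable_return_prob_space])
       (use that in \<open>simp add: R_def\<close>)
  have \<kappa>: "\<kappa> \<in> F \<rightarrow>\<^sub>M prob_algebra R"
    unfolding \<kappa>_def
  proof (rule measurable_bind_prob_space2[OF Q])
    show "(\<lambda>(\<omega>, z). return R (\<omega>, z)) \<in> F \<Otimes>\<^sub>M S \<rightarrow>\<^sub>M prob_algebra R"
      unfolding R_def using measurable_return_prob_space[of "F \<Otimes>\<^sub>M S"] by (simp add: case_prod_eta)
  qed
  have Qsp: "Q \<omega> \<in> space (prob_algebra S)" if "\<omega> \<in> space F" for \<omega>
    using measurable_space[OF Q that] .
  have rect: "emeasure (distr M R (\<lambda>\<omega>. (\<omega>, X \<omega>))) (A \<times> B) = emeasure (N \<bind> \<kappa>) (A \<times> B)"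
    if A: "A \<in> sets F" and B: "B \<in> sets S" for A B
  proof -
    have AB: "A \<times> B \<in> sets R"
      using A B by (simp add: R_def)
    have AM [measurable]: "A \<in> sets M" using A setsF by blast
    have BM [measurable]: "X -` B \<inter> space M \<in> sets M"
      using B by measurable
    have mQ: "(\<lambda>\<omega>. measure (Q \<omega>) B) \<in> borel_measurable F"
      using measurable_compose[OF Q measurable_measure_prob_algebra[OF B]] .
    have mQM [measurable]: "(\<lambda>\<omega>. measure (Q \<omega>) B) \<in> borel_measurable M"
      by (rule measurable_from_subalg[OF sub mQ])
    have \<kappa>_rect: "emeasure (\<kappa> \<omega>) (A \<times> B) = ennreal (indicator A \<omega> * measure (Q \<omega>) B)"
      if \<omega>: "\<omega> \<in> space F" for \<omega>
    proof -
      interpret Q: prob_space "Q \<omega>" using Qsp[OF \<omega>] by (simp add: space_prob_algebra)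
      have sQ: "sets (Q \<omega>) = sets S" using Qsp[OF \<omega>] by (simp add: space_prob_algebra)
      have "emeasure (\<kappa> \<omega>) (A \<times> B) = (\<integral>\<^sup>+z. emeasure (return R (\<omega>, z)) (A \<times> B) \<partial>Q \<omega>)"
        unfolding \<kappa>_def by (rule emeasure_bind_prob_algebra[OF Qsp[OF \<omega>] ret[OF \<omega>] AB])
      also have "\<dots> = (\<integral>\<^sup>+z. indicator A \<omega> * indicator B z \<partial>Q \<omega>)"
        using AB by (intro nn_integral_cong) (simp split: split_indicator)
      also have "\<dots> = indicator A \<omega> * emeasure (Q \<omega>) B"
        using B sQ by (simp add: nn_integral_cmult)
      also have "\<dots> = ennreal (indicator A \<omega> * measure (Q \<omega>) B)"
        by (simp add: Q.emeasure_eq_measure split: split_indicator)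
      finally show ?thesis .
    qed
    have intA: "integrable M (\<lambda>\<omega>. indicator A \<omega> * indicator (X -` B \<inter> space M) \<omega> :: real)"
      by (rule integrable_const_bound[where B = 1]) (auto split: split_indicator)
    have "prob (A \<inter> (X -` B \<inter> space M)) = (\<integral>\<omega>. indicator A \<omega> * indicator (X -` B \<inter> space M) \<omega> \<partial>M)"
      by (simp flip: indicator_inter_arith)
    \<comment> \<open>The defining property of conditional expectation, tested against the indicator
      of a set in \<open>F\<close>.\<close>
    also have "\<dots> = (\<integral>\<omega>. indicator A \<omega> * real_cond_exp M F (indicator (X -` B \<inter> space M)) \<omega> \<partial>M)"
      using intA A by (intro real_cond_exp_intg(2)[symmetric]) auto
    also have "\<dots> = (\<integral>\<omega>. indicator A \<omega> * measure (Q \<omega>) B \<partial>M)"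
      using cond[OF B] by (intro integral_cong_AE) auto
    finally have prob_eq: "prob (A \<inter> (X -` B \<inter> space M)) = (\<integral>\<omega>. indicator A \<omega> * measure (Q \<omega>) B \<partial>M)" .
    have intQ: "integrable M (\<lambda>\<omega>. indicator A \<omega> * measure (Q \<omega>) B)"
    proof (rule integrable_const_bound[where B = 1], rule AE_I2)
      fix \<omega> assume "\<omega> \<in> space M"
      then have "prob_space (Q \<omega>)" using Qsp spF by (simp add: space_prob_algebra)
      then show "norm (indicator A \<omega> * measure (Q \<omega>) B) \<le> 1"
        by (simp add: prob_space.prob_le_1 split: split_indicator)
    qed measurable
    have "emeasure (N \<bind> \<kappa>) (A \<times> B) = (\<integral>\<^sup>+\<omega>. emeasure (\<kappa> \<omega>) (A \<times> B) \<partial>N)"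
      by (rule emeasure_bind_prob_algebra[OF N \<kappa> AB])
    also have "\<dots> = (\<integral>\<^sup>+\<omega>. ennreal (indicator A \<omega> * measure (Q \<omega>) B) \<partial>N)"
      using \<kappa>_rect by (intro nn_integral_cong) (simp add: N_def space_restr_to_subalg spF)
    also have "\<dots> = (\<integral>\<^sup>+\<omega>. ennreal (indicator A \<omega> * measure (Q \<omega>) B) \<partial>M)"
      unfolding N_def using A mQ by (intro nn_integral_subalgebra2[OF sub]) auto
    also have "\<dots> = ennreal (\<integral>\<omega>. indicator A \<omega> * measure (Q \<omega>) B \<partial>M)"
      using intQ by (intro nn_integral_eq_integral) auto
    also have "\<dots> = emeasure M (A \<inter> (X -` B \<inter> space M))"
      by (simp add: prob_eq[symmetric] emeasure_eq_measure)
    also have "A \<inter> (X -` B \<inter> space M) = (\<lambda>\<omega>. (\<omega>, X \<omega>)) -` (A \<times> B) \<inter> space M"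
      by auto
    also have "emeasure M \<dots> = emeasure (distr M R (\<lambda>\<omega>. (\<omega>, X \<omega>))) (A \<times> B)"
      using AB by (simp add: emeasure_distr)
    finally show ?thesis by simp
  qed
  have setsB: "sets (N \<bind> \<kappa>) = sets R"
    using N \<kappa> by (intro sets_bind[of _ _ R])
      (use Qsp in \<open>auto simp: space_prob_algebra N_def space_restr_to_subalg spF not_empty dest: measurable_space\<close>)
  \<comment> \<open>Rectangles form an intersection-stable generator, and both measures are finite
    on the whole product, so agreement on rectangles is enough.\<close>
  have law: "distr M R (\<lambda>\<omega>. (\<omega>, X \<omega>)) = N \<bind> \<kappa>"
  proof (rule measure_eqI_generator_eq[OF Int_stable_pair_measure_generator[of F S]])
    show "{a \<times> b |a b. a \<in> sets F \<and> b \<in> sets S} \<subseteq> Pow (space F \<times> space S)"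
      by (rule pair_measure_closed)
    show "range (\<lambda>i. space F \<times> space S) \<subseteq> {a \<times> b |a b. a \<in> sets F \<and> b \<in> sets S}"
      by blast
    show "sets (distr M R (\<lambda>\<omega>. (\<omega>, X \<omega>))) = sigma_sets (space F \<times> space S) {a \<times> b |a b. a \<in> sets F \<and> b \<in> sets S}"
      by (simp add: R_def sets_pair_measure)
    show "sets (N \<bind> \<kappa>) = sigma_sets (space F \<times> space S) {a \<times> b |a b. a \<in> sets F \<and> b \<in> sets S}"
      by (simp add: setsB) (simp add: R_def sets_pair_measure)
    show "emeasure (distr M R (\<lambda>\<omega>. (\<omega>, X \<omega>))) (space F \<times> space S) \<noteq> \<infinity>" for i :: nat
      using finite_measure.emeasure_finite[OF finite_measure_distr[OF pair]] by simp
  qed (use rect in auto)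
  have "(\<integral>\<omega>. H (\<omega>, X \<omega>) \<partial>M) = (\<integral>x. H x \<partial>(N \<bind> \<kappa>))"
    unfolding law[symmetric] using H by (simp add: integral_distr R_def[symmetric])
  also have "\<dots> = (\<integral>\<omega>. (\<integral>x. H x \<partial>\<kappa> \<omega>) \<partial>N)"
    using H bound by (intro integral_kernel_bind[OF N \<kappa>]) (auto simp: R_def)
  also have "\<dots> = (\<integral>\<omega>. (\<integral>x. H x \<partial>\<kappa> \<omega>) \<partial>M)"
    unfolding N_def
  proof (rule integral_subalgebra2[OF sub])
    show "(\<lambda>\<omega>. \<integral>x. H x \<partial>\<kappa> \<omega>) \<in> borel_measurable F"
      by (rule measurable_compose[OF measurable_prob_algebraD[OF \<kappa>] integral_measurable_subprob_algebra])
         (use H in \<open>simp add: R_def\<close>)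
  qed
  also have "\<dots> = (\<integral>\<omega>. (\<integral>z. H (\<omega>, z) \<partial>Q \<omega>) \<partial>M)"
  proof (rule Bochner_Integration.integral_cong[OF refl])
    fix \<omega> assume "\<omega> \<in> space M"
    then have \<omega>: "\<omega> \<in> space F" using spF by simp
    have "(\<integral>x. H x \<partial>\<kappa> \<omega>) = (\<integral>z. (\<integral>x. H x \<partial>return R (\<omega>, z)) \<partial>Q \<omega>)"
      unfolding \<kappa>_def using H bound by (intro integral_kernel_bind[OF Qsp[OF \<omega>] ret[OF \<omega>]]) (auto simp: R_def)
    also have "\<dots> = (\<integral>z. H (\<omega>, z) \<partial>Q \<omega>)"
    proof (rule Bochner_Integration.integral_cong[OF refl])
      fix z assume "z \<in> space (Q \<omega>)"
      then have "z \<in> space S"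
        using Qsp[OF \<omega>] by (auto simp: space_prob_algebra dest: sets_eq_imp_space_eq)
      then show "(\<integral>x. H x \<partial>return R (\<omega>, z)) = H (\<omega>, z)"
        using H \<omega> by (intro integral_return) (auto simp: R_def space_pair_measure)
    qed
    finally show "(\<integral>x. H x \<partial>\<kappa> \<omega>) = (\<integral>z. H (\<omega>, z) \<partial>Q \<omega>)" .
  qed
  finally show ?thesis .
qed

subsection \<open>The Poisson equation\<close>

context adaptive_mcmc_setting
begin

text \<open>The sigma-algebra on the space of measures is generated by the evaluations at sets, so
  the setwise assumption \<open>joint_measurable\<close> upgrades to measurability of the kernel as
  a measure-valued map.\<close>

lemma measurable_kernel_joint: "(\<lambda>(y, \<gamma>). P \<gamma> y) \<in> state_space \<Otimes>\<^sub>M I \<rightarrow>\<^sub>M prob_algebra state_space"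
proof (rule measurable_prob_algebraI)
  have K: "P \<gamma> y \<in> space (prob_algebra state_space)" if "\<gamma> \<in> space I" for y \<gamma>
    using measurable_space[OF kernel[OF that]] by (simp add: space_pair_measure)
  show "prob_space (case x of (y, \<gamma>) \<Rightarrow> P \<gamma> y)" if "x \<in> space (state_space \<Otimes>\<^sub>M I)" for x
    using that K by (auto simp: space_pair_measure space_prob_algebra)
  show "(\<lambda>(y, \<gamma>). P \<gamma> y) \<in> state_space \<Otimes>\<^sub>M I \<rightarrow>\<^sub>M subprob_algebra state_space"
  proof (rule measurable_subprob_algebra)
    fix x :: "('x \<times> 'p) \<times> 'i" assume x: "x \<in> space (state_space \<Otimes>\<^sub>M I)"
    show "subprob_space (case x of (y, \<gamma>) \<Rightarrow> P \<gamma> y)" "sets (case x of (y, \<gamma>) \<Rightarrow> P \<gamma> y) = sets state_space"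
      using x K by (auto simp: space_pair_measure space_prob_algebra intro: prob_space_imp_subprob_space)
  next
    fix A :: "('x \<times> 'p) set" assume A: "A \<in> sets state_space"
    have "(\<lambda>x. ennreal (case x of (y, \<gamma>) \<Rightarrow> measure (P \<gamma> y) A)) \<in> borel_measurable (state_space \<Otimes>\<^sub>M I)"
      using joint_measurable[OF A] by measurable
    moreover have "emeasure (case x of (y, \<gamma>) \<Rightarrow> P \<gamma> y) A = ennreal (case x of (y, \<gamma>) \<Rightarrow> measure (P \<gamma> y) A)"
      if "x \<in> space (state_space \<Otimes>\<^sub>M I)" for x
      using that K by (auto simp: space_pair_measure space_prob_algebra prob_space.finite_measure
          intro!: finite_measure.emeasure_eq_measure)
    ultimately show "(\<lambda>x. emeasure (case x of (y, \<gamma>) \<Rightarrow> P \<gamma> y) A) \<in> borel_measurable (state_space \<Otimes>\<^sub>M I)"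
      by (subst measurable_cong)
  qed
qed

text \<open>All the \<open>\<pi> \<gamma>\<close> share the first marginal \<open>\<nu>\<close>, so
  one constant centres \<open>f\<close> under every parameter.\<close>

lemma integral_pi_fst:
  fixes f :: "'x \<Rightarrow> real"
  assumes \<gamma>: "\<gamma> \<in> space I" and f: "f \<in> borel_measurable borel"
  shows "(\<integral>y. f (fst y) \<partial>\<pi> \<gamma>) = (\<integral>x. f x \<partial>\<nu>)"
proof -
  have sets: "sets (\<pi> \<gamma>) = sets state_space" "sets \<nu> = sets borel"
    using pi_prob[OF \<gamma>] nu_prob by (auto simp: space_prob_algebra)
  have fst: "fst \<in> \<pi> \<gamma> \<rightarrow>\<^sub>M borel"
    using measurable_fst measurable_cong_sets[OF sets(1) refl] by blast
  have "distr (\<pi> \<gamma>) borel fst = \<nu>"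
  proof (rule measure_eqI)
    fix B assume "B \<in> sets (distr (\<pi> \<gamma>) borel fst)"
    then have B: "B \<in> sets borel" by simp
    have "fst -` B \<inter> space (\<pi> \<gamma>) = B \<times> UNIV"
      using sets_eq_imp_space_eq[OF sets(1)] by (auto simp: space_pair_measure)
    then show "emeasure (distr (\<pi> \<gamma>) borel fst) B = emeasure \<nu> B"
      using fst B marginal[OF \<gamma> B] by (simp add: emeasure_distr)
  qed (simp add: sets)
  then show ?thesis
    using integral_distr[OF fst f] by simp
qed

text \<open>Total variation convergence makes the terms of the Neumann series decay geometrically,
  with constants free of the state and the parameter; the bound \<open>H\<close> is the sum of the
  dominating geometric series. Integrating against the kernel shifts the series by one index, which
  removes exactly its first term \<open>g\<close>.\<close>

lemma poisson_equation:
  fixes g :: "'x \<times> 'p \<Rightarrow> real"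
  assumes tau: "0 \<le> \<tau>" "\<tau> < 1" and Lambda: "0 < \<Lambda>"
    and ergodic: "\<And>\<gamma> y l. \<gamma> \<in> space I \<Longrightarrow> l \<ge> 1 \<Longrightarrow>
          tv_dist state_space (kernel_pow state_space (P \<gamma>) l y) (\<pi> \<gamma>) \<le> \<Lambda> * \<tau> ^ l"
    and g [measurable]: "g \<in> borel_measurable state_space"
    and bound: "\<And>y. \<bar>g y\<bar> \<le> c" and c: "c > 0"
    and centred: "\<And>\<gamma>. \<gamma> \<in> space I \<Longrightarrow> (\<integral>y. g y \<partial>\<pi> \<gamma>) = 0"
  obtains u H where "(\<lambda>(y, \<gamma>). u y \<gamma>) \<in> borel_measurable (state_space \<Otimes>\<^sub>M I)"
    "\<And>y \<gamma>. \<gamma> \<in> space I \<Longrightarrow> \<bar>u y \<gamma>\<bar> \<le> H"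
    "\<And>y \<gamma>. \<gamma> \<in> space I \<Longrightarrow> (\<integral>z. u z \<gamma> \<partial>P \<gamma> y) = u y \<gamma> - g y"
proof
  define G where "G = (\<lambda>l y \<gamma>. \<integral>z. g z \<partial>kernel_pow state_space (P \<gamma>) l y)"
  \<comment> \<open>The summand 1 covers \<open>l = 0\<close>, where \<open>ergodic\<close> says
    nothing and only \<open>\<bar>g y\<bar> \<le> c\<close> is available. The summand
    \<open>2 * \<Lambda>\<close> comes from the total variation bound for
    \<open>l \<ge> 1\<close>.\<close>
  define a where "a = c * (1 + 2 * \<Lambda>)"
  have G_joint [measurable]: "(\<lambda>(y, \<gamma>). G l y \<gamma>) \<in> borel_measurable (state_space \<Otimes>\<^sub>M I)" for l
    using measurable_compose[OF measurable_prob_algebraD[OF measurable_kernel_pow_joint[OF measurable_kernel_joint]]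
        integral_measurable_subprob_algebra[OF g], of l]
    by (simp add: G_def case_prod_beta')
  have G_meas: "(\<lambda>y. G l y \<gamma>) \<in> borel_measurable state_space" if "\<gamma> \<in> space I" for l \<gamma>
    using measurable_compose[OF measurable_Pair2'[OF that] G_joint] by simp
  have pow: "kernel_pow state_space (P \<gamma>) l y \<in> space (prob_algebra state_space)" if "\<gamma> \<in> space I" for \<gamma> l y
    using measurable_space[OF measurable_kernel_pow[OF kernel[OF that]]] by (simp add: space_pair_measure)
  have G_0: "G 0 y \<gamma> = g y" for y \<gamma>
    by (simp add: G_def integral_return space_pair_measure)
  have G_le: "\<bar>G l y \<gamma>\<bar> \<le> a * \<tau> ^ l" if \<gamma>: "\<gamma> \<in> space I" for l y \<gamma>
  proof (cases "l = 0")
    case True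
    have "c \<le> a" using c Lambda by (simp add: a_def)
    with True bound[of y] show ?thesis by (simp add: G_0)
  next
    case False
    have "\<bar>G l y \<gamma>\<bar> = \<bar>(\<integral>z. g z \<partial>kernel_pow state_space (P \<gamma>) l y) - (\<integral>z. g z \<partial>\<pi> \<gamma>)\<bar>"
      by (simp add: G_def centred[OF \<gamma>])
    also have "\<dots> \<le> 2 * c * tv_dist state_space (kernel_pow state_space (P \<gamma>) l y) (\<pi> \<gamma>)"
      by (rule integral_diff_le_tv_dist[OF pow[OF \<gamma>] pi_prob[OF \<gamma>] g bound c])
    also have "\<dots> \<le> 2 * c * (\<Lambda> * \<tau> ^ l)"
      using ergodic[OF \<gamma>, of l y] False c by (intro mult_left_mono) auto
    also have "\<dots> \<le> a * \<tau> ^ l"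
      using c Lambda tau by (simp add: a_def algebra_simps)
    finally show ?thesis .
  qed
  have geo: "summable (\<lambda>l. a * \<tau> ^ l)"
    using tau by (intro summable_mult summable_geometric) simp
  have G_summable: "summable (\<lambda>l. \<bar>G l y \<gamma>\<bar>)" if "\<gamma> \<in> space I" for y \<gamma>
    by (rule summable_comparison_test'[OF geo, of 0]) (use G_le[OF that] in auto)
  define u where "u = (\<lambda>y \<gamma>. \<Sum>l. G l y \<gamma>)"
  have "(\<lambda>x. \<Sum>l. (case x of (y, \<gamma>) \<Rightarrow> G l y \<gamma>)) \<in> borel_measurable (state_space \<Otimes>\<^sub>M I)"
    by measurable
  then show "(\<lambda>(y, \<gamma>). u y \<gamma>) \<in> borel_measurable (state_space \<Otimes>\<^sub>M I)"
    by (simp add: u_def case_prod_beta')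
  show "\<bar>u y \<gamma>\<bar> \<le> (\<Sum>l. a * \<tau> ^ l)" if \<gamma>: "\<gamma> \<in> space I" for y \<gamma>
  proof -
    have "\<bar>u y \<gamma>\<bar> \<le> (\<Sum>l. \<bar>G l y \<gamma>\<bar>)"
      unfolding u_def by (rule summable_rabs[OF G_summable[OF \<gamma>]])
    also have "\<dots> \<le> (\<Sum>l. a * \<tau> ^ l)"
      by (rule suminf_le[OF _ G_summable[OF \<gamma>] geo]) (rule G_le[OF \<gamma>])
    finally show ?thesis .
  qed
  show "(\<integral>z. u z \<gamma> \<partial>P \<gamma> y) = u y \<gamma> - g y" if \<gamma>: "\<gamma> \<in> space I" for y \<gamma>
  proof -
    have K: "P \<gamma> y \<in> space (prob_algebra state_space)"
      using measurable_space[OF kernel[OF \<gamma>]] by (simp add: space_pair_measure)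
    then have sets [measurable_cong]: "sets (P \<gamma> y) = sets state_space"
      by (simp add: space_prob_algebra)
    interpret K: prob_space "P \<gamma> y" using K by (simp add: space_prob_algebra)
    have int: "integrable (P \<gamma> y) (\<lambda>z. G l z \<gamma>)" for l
      by (rule K.integrable_const_bound[where B = "a * \<tau> ^ l"])
         (use G_le[OF \<gamma>] G_meas[OF \<gamma>] measurable_cong_sets[OF sets refl] in auto)
    have step: "(\<integral>z. G l z \<gamma> \<partial>P \<gamma> y) = G (Suc l) y \<gamma>" for l
      unfolding G_def kernel_pow.simps
      by (rule integral_kernel_bind[OF K measurable_kernel_pow[OF kernel[OF \<gamma>]] g bound, symmetric])
    \<comment> \<open>The series and the integral may be exchanged because the geometric majorant
      controls the terms both pointwise and in mean.\<close>
    have "(\<integral>z. u z \<gamma> \<partial>P \<gamma> y) = (\<Sum>l. \<integral>z. G l z \<gamma> \<partial>P \<gamma> y)"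
      unfolding u_def
    proof (rule integral_suminf[OF int])
      show "AE z in P \<gamma> y. summable (\<lambda>l. norm (G l z \<gamma>))"
        using G_summable[OF \<gamma>] by simp
      have "(\<integral>z. norm (G l z \<gamma>) \<partial>P \<gamma> y) \<le> a * \<tau> ^ l" for l
        using int G_le[OF \<gamma>] by (intro K.integral_le_const) auto
      then show "summable (\<lambda>l. \<integral>z. norm (G l z \<gamma>) \<partial>P \<gamma> y)"
        by (intro summable_comparison_test'[OF geo, of 0]) (auto simp: integral_nonneg)
    qed
    also have "\<dots> = u y \<gamma> - G 0 y \<gamma>"
      unfolding step u_def using suminf_split_head[OF summable_rabs_cancel[OF G_summable[OF \<gamma>]]] by simp
    finally show ?thesis by (simp add: G_0)
  qed
qed

end

subsection \<open>Transitions and blocks of the chain\<close>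

context air_mcmc_chain
begin

abbreviation history :: "nat \<Rightarrow> 'w measure" where
  "history n \<equiv> history_algebra M state_space I Y \<Gamma> n"

lemma
  shows space_history: "space (history n) = space M"
    and sets_history: "sets (history n) = sigma_sets (space M)
      (\<Union>i\<le>n. {Y i -` A \<inter> space M | A. A \<in> sets state_space} \<union> {\<Gamma> i -` B \<inter> space M | B. B \<in> sets I})"
  unfolding history_algebra_def by (auto intro!: space_measure_of sets_measure_of)

lemma subalgebra_history: "subalgebra M (history n)"
  unfolding subalgebra_def space_history sets_history
  using measurable_sets[OF Y_measurable] measurable_sets[OF Gamma_measurable]
  by (auto intro!: sets.sigma_sets_subset)

lemma Y_measurable_history: "i \<le> n \<Longrightarrow> Y i \<in> history n \<rightarrow>\<^sub>M state_space"
  using measurable_space[OF Y_measurable]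
  by (intro measurableI) (auto simp: space_history sets_history intro!: sigma_sets.Basic)

lemma Gamma_measurable_history: "i \<le> n \<Longrightarrow> \<Gamma> i \<in> history n \<rightarrow>\<^sub>M I"
  using measurable_space[OF Gamma_measurable]
  by (intro measurableI) (auto simp: space_history sets_history intro!: sigma_sets.Basic)

text \<open>The transition law in integrated form: only the state at time \<open>Suc n\<close> is
  averaged out, while the argument \<open>\<omega>\<close> of \<open>H\<close> carries the whole
  history up to \<open>n\<close>.\<close>

lemma integral_transition:
  assumes H: "H \<in> borel_measurable (history n \<Otimes>\<^sub>M state_space)"
    and bound: "\<And>\<omega> z. \<omega> \<in> space M \<Longrightarrow> \<bar>H (\<omega>, z)\<bar> \<le> (c :: real)"
  shows "(\<integral>\<omega>. H (\<omega>, Y (Suc n) \<omega>) \<partial>M) = (\<integral>\<omega>. (\<integral>z. H (\<omega>, z) \<partial>P (\<Gamma> n \<omega>) (Y n \<omega>)) \<partial>M)"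
proof (rule integral_regular_conditional_law[OF subalgebra_history _ Y_measurable transition H])
  have "(\<lambda>\<omega>. (Y n \<omega>, \<Gamma> n \<omega>)) \<in> history n \<rightarrow>\<^sub>M state_space \<Otimes>\<^sub>M I"
    by (intro measurable_Pair Y_measurable_history Gamma_measurable_history order_refl)
  from measurable_compose[OF this measurable_kernel_joint]
  show "(\<lambda>\<omega>. P (\<Gamma> n \<omega>) (Y n \<omega>)) \<in> history n \<rightarrow>\<^sub>M prob_algebra state_space"
    by simp
qed (use bound in \<open>auto simp: space_pair_measure space_history\<close>)

section \<open>Counting the parameter changes\<close>

lemma air_time_Suc: "air_time \<beta> (Suc m) = air_time \<beta> m + air_lag \<beta> (Suc m)"
  by (simp add: air_time_def)

lemma air_lag_ge: "\<beta> \<ge> 1 \<Longrightarrow> j \<le> air_lag \<beta> j"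
proof (cases "j = 0")
  case False
  assume "\<beta> \<ge> 1"
  with False have "real j powr 1 \<le> real j powr \<beta>"
    by (intro powr_mono) auto
  then show ?thesis
    using False by (simp add: air_lag_def) linarith
qed simp

text \<open>For \<open>\<beta> \<ge> 1\<close> the lags dominate 1, 2, ..., m, whose sum is at least
  \<open>m^2 / 2\<close>. This quadratic growth is the source of the square root in the number of
  adaptations.\<close>

lemma air_time_ge: "\<beta> \<ge> 1 \<Longrightarrow> m ^ 2 \<le> 2 * air_time \<beta> m"
proof (induction m)
  case (Suc m)
  then show ?case
    using air_lag_ge[of "Suc m"] by (simp add: air_time_Suc power2_eq_square)
qed simp

text \<open>Every \<open>i\<close> lies in some block, because the adaptation times are unbounded. A
  change at \<open>Suc i\<close> means that \<open>Suc i\<close> has left the block of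
  \<open>i\<close>, hence starts the next one.\<close>

lemma parameter_change_time:
  assumes beta: "\<beta> \<ge> 1" and \<omega>: "\<omega> \<in> space M" and neq: "\<Gamma> (Suc i) \<omega> \<noteq> \<Gamma> i \<omega>"
  shows "\<exists>j. Suc i = air_time \<beta> (Suc j)"
proof -
  have "\<exists>m. i < air_time \<beta> m"
  proof
    have "(Suc (2 * i))\<^sup>2 \<le> 2 * air_time \<beta> (Suc (2 * i))"
      by (rule air_time_ge[OF beta])
    then show "i < air_time \<beta> (Suc (2 * i))"
      by (simp add: power2_eq_square)
  qed
  moreover have "\<not> i < air_time \<beta> 0"
    by (simp add: air_time_def)
  ultimately obtain j where j: "\<not> i < air_time \<beta> j" "i < air_time \<beta> (Suc j)"
    using ex_least_nat_less[of "\<lambda>m. i < air_time \<beta> m"] by blast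
  have "\<not> Suc i < air_time \<beta> (Suc j)"
  proof
    assume "Suc i < air_time \<beta> (Suc j)"
    then have "\<Gamma> (Suc i) \<omega> = \<Gamma> i \<omega>"
      using j by (intro adaptation_times[OF _ _ \<omega>, of _ j]) auto
    with neq show False ..
  qed
  with j show ?thesis
    by (intro exI[of _ j]) simp
qed

lemma card_parameter_changes:
  assumes beta: "\<beta> \<ge> 1" and \<omega>: "\<omega> \<in> space M"
  shows "real (card {i\<in>{..<n}. \<Gamma> (Suc i) \<omega> \<noteq> \<Gamma> i \<omega>}) \<le> sqrt (2 * real n)"
proof -
  define m where "m = nat \<lfloor>sqrt (2 * real n)\<rfloor>"
  \<comment> \<open>A change from \<open>i\<close> to \<open>Suc i\<close> has \<open>Suc i\<close>
    equal to an adaptation time, hence the shift by one. Its index \<open>j\<close> satisfies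
    \<open>j^2 \<le> 2 * n\<close> by \<open>air_time_ge\<close>, and \<open>m\<close> is the
    largest such index.\<close>
  have "{i\<in>{..<n}. \<Gamma> (Suc i) \<omega> \<noteq> \<Gamma> i \<omega>} \<subseteq> (\<lambda>j. air_time \<beta> j - 1) ` {1..m}"
  proof
    fix i assume "i \<in> {i\<in>{..<n}. \<Gamma> (Suc i) \<omega> \<noteq> \<Gamma> i \<omega>}"
    then have i: "i < n" and "\<Gamma> (Suc i) \<omega> \<noteq> \<Gamma> i \<omega>" by auto
    then obtain j where j: "Suc i = air_time \<beta> (Suc j)"
      using parameter_change_time[OF beta \<omega>] by blast
    have "(Suc j)\<^sup>2 \<le> 2 * n"
      using air_time_ge[OF beta, of "Suc j"] j i by linarith
    then have "real ((Suc j)\<^sup>2) \<le> real (2 * n)"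
      by (rule of_nat_mono)
    then have "real (Suc j) \<le> sqrt (2 * real n)"
      by (intro real_le_rsqrt) simp
    then have "Suc j \<le> m"
      unfolding m_def by (rule le_nat_floor)
    then show "i \<in> (\<lambda>j. air_time \<beta> j - 1) ` {1..m}"
      using j by (intro image_eqI[of _ _ "Suc j"]) auto
  qed
  then have "card {i\<in>{..<n}. \<Gamma> (Suc i) \<omega> \<noteq> \<Gamma> i \<omega>} \<le> card ((\<lambda>j. air_time \<beta> j - 1) ` {1..m})"
    by (intro card_mono) auto
  also have "\<dots> \<le> m"
    using card_image_le[of "{1..m}" "\<lambda>j. air_time \<beta> j - 1"] by simp
  finally have "real (card {i\<in>{..<n}. \<Gamma> (Suc i) \<omega> \<noteq> \<Gamma> i \<omega>}) \<le> real m" by simp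
  also have "\<dots> \<le> sqrt (2 * real n)"
    unfolding m_def by (intro of_nat_floor) simp
  finally show ?thesis .
qed

text \<open>The sum would telescope if the parameter in the second term were
  \<open>\<Gamma> (Suc i)\<close>. The correction \<open>d i\<close> vanishes unless the parameter
  changes, so the two boundary terms and at most \<open>sqrt (2 * n)\<close> corrections remain,
  each correction being at most \<open>2 * b\<close>.\<close>

lemma block_telescoping_bound:
  fixes v :: "'x \<times> 'p \<Rightarrow> 'i \<Rightarrow> real"
  assumes beta: "\<beta> \<ge> 1" and \<omega>: "\<omega> \<in> space M"
    and v: "\<And>y \<gamma>. \<gamma> \<in> space I \<Longrightarrow> \<bar>v y \<gamma>\<bar> \<le> b"
  shows "\<bar>\<Sum>i<n. v (Y i \<omega>) (\<Gamma> i \<omega>) - v (Y (Suc i) \<omega>) (\<Gamma> i \<omega>)\<bar> \<le> 2 * b * (1 + sqrt (2 * real n))"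
proof -
  have \<Gamma>: "\<Gamma> i \<omega> \<in> space I" for i
    using measurable_space[OF Gamma_measurable \<omega>] .
  have b: "\<bar>v y (\<Gamma> i \<omega>)\<bar> \<le> b" for y i
    by (rule v[OF \<Gamma>])
  have b0: "0 \<le> b" using b[of y0 0] by linarith
  define J where "J = {i\<in>{..<n}. \<Gamma> (Suc i) \<omega> \<noteq> \<Gamma> i \<omega>}"
  define d where "d = (\<lambda>i. v (Y (Suc i) \<omega>) (\<Gamma> (Suc i) \<omega>) - v (Y (Suc i) \<omega>) (\<Gamma> i \<omega>))"
  have "(\<Sum>i<n. v (Y i \<omega>) (\<Gamma> i \<omega>) - v (Y (Suc i) \<omega>) (\<Gamma> i \<omega>))
      = (\<Sum>i<n. v (Y i \<omega>) (\<Gamma> i \<omega>) - v (Y (Suc i) \<omega>) (\<Gamma> (Suc i) \<omega>)) + (\<Sum>i<n. d i)"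
    by (simp add: d_def flip: sum.distrib)
  also have "(\<Sum>i<n. v (Y i \<omega>) (\<Gamma> i \<omega>) - v (Y (Suc i) \<omega>) (\<Gamma> (Suc i) \<omega>))
      = v (Y 0 \<omega>) (\<Gamma> 0 \<omega>) - v (Y n \<omega>) (\<Gamma> n \<omega>)"
    by (rule sum_lessThan_telescope')
  also have "(\<Sum>i<n. d i) = (\<Sum>i\<in>J. d i)"
    by (rule sum.mono_neutral_right) (auto simp: J_def d_def)
  finally have "\<bar>\<Sum>i<n. v (Y i \<omega>) (\<Gamma> i \<omega>) - v (Y (Suc i) \<omega>) (\<Gamma> i \<omega>)\<bar> \<le> 2 * b + \<bar>\<Sum>i\<in>J. d i\<bar>"
    using b[of "Y 0 \<omega>" 0] b[of "Y n \<omega>" n] by linarith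
  also have "\<bar>\<Sum>i\<in>J. d i\<bar> \<le> (\<Sum>i\<in>J. \<bar>d i\<bar>)"
    by (rule sum_abs)
  also have "\<dots> \<le> real (card J) * (2 * b)"
  proof (rule sum_bounded_above)
    show "\<bar>d i\<bar> \<le> 2 * b" for i
      unfolding d_def using b[of "Y (Suc i) \<omega>" i] b[of "Y (Suc i) \<omega>" "Suc i"] by linarith
  qed
  also have "\<dots> \<le> sqrt (2 * real n) * (2 * b)"
    using card_parameter_changes[OF beta \<omega>, of n] b0 unfolding J_def by (intro mult_right_mono) auto
  finally show ?thesis by (simp add: algebra_simps)
qed

end

section \<open>Martingale decomposition of the centred partial sums\<close>

theorem theorem4p4:
  fixes I :: "'i measure"
    and \<nu> :: "'x::polish_space measure"
    and \<pi> :: "'i \<Rightarrow> ('x \<times> 'p::polish_space) measure"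
    and P :: "'i \<Rightarrow> 'x \<times> 'p \<Rightarrow> ('x \<times> 'p) measure"
    and M :: "'w measure"
    and \<beta> \<tau> \<Lambda> \<epsilon> :: real
    and y0 :: "'x \<times> 'p"
    and \<gamma>0 :: 'i
    and Y :: "nat \<Rightarrow> 'w \<Rightarrow> 'x \<times> 'p"
    and \<Gamma> :: "nat \<Rightarrow> 'w \<Rightarrow> 'i"
    and f :: "'x \<Rightarrow> real"
  assumes chain: "air_mcmc_chain I \<nu> \<pi> P M \<beta> y0 \<gamma>0 Y \<Gamma>"
    and beta: "\<beta> \<ge> 1"
    and tau: "0 \<le> \<tau>" "\<tau> < 1"
    and Lambda: "0 < \<Lambda>"
    and ergodic: "\<And>\<gamma> y l. \<gamma> \<in> space I \<Longrightarrow> l \<ge> 1 \<Longrightarrow>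
          tv_dist state_space (kernel_pow state_space (P \<gamma>) l y) (\<pi> \<gamma>) \<le> \<Lambda> * \<tau> ^ l"
    and f_measurable: "f \<in> borel_measurable borel"
    and f_bounded: "bounded (range f)"
    and eps: "\<epsilon> > 0"
  shows "AE \<omega> in M.
    (\<lambda>n. 1 / (sqrt (real n) * ln (real n) powr (1 / 2 + \<epsilon>)) *
         (\<Sum>j=1..n. (f (fst (Y j \<omega>)) - (\<integral>x. f x \<partial>\<nu>)))) \<longlonglongrightarrow> 0"
proof -
  interpret air_mcmc_chain I \<nu> \<pi> P M \<beta> y0 \<gamma>0 Y \<Gamma> by (rule chain)
  define g :: "'x \<times> 'p \<Rightarrow> real" where "g = (\<lambda>y. f (fst y) - (\<integral>x. f x \<partial>\<nu>))"
  have g [measurable]: "g \<in> borel_measurable state_space"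
    unfolding g_def using f_measurable by measurable
  obtain b where b: "\<And>x. \<bar>f x\<bar> \<le> b"
    using f_bounded by (auto simp: bounded_iff)
  \<comment> \<open>The added 1 keeps \<open>c\<close> strictly positive even when \<open>f\<close>
    vanishes identically.\<close>
  define c where "c = b + \<bar>\<integral>x. f x \<partial>\<nu>\<bar> + 1"
  have g_bound: "\<bar>g y\<bar> \<le> c" for y
    using b[of "fst y"] by (simp add: g_def c_def)
  have c: "c > 0"
    using b[of undefined] by (simp add: c_def)
  have centred: "(\<integral>y. g y \<partial>\<pi> \<gamma>) = 0" if \<gamma>: "\<gamma> \<in> space I" for \<gamma>
  proof -
    have sets [measurable_cong]: "sets (\<pi> \<gamma>) = sets state_space"
      using pi_prob[OF \<gamma>] by (simp add: space_prob_algebra)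
    interpret pi: prob_space "\<pi> \<gamma>" using pi_prob[OF \<gamma>] by (simp add: space_prob_algebra)
    have "(\<lambda>y. f (fst y)) \<in> borel_measurable (\<pi> \<gamma>)"
      using f_measurable by measurable
    then have "integrable (\<pi> \<gamma>) (\<lambda>y. f (fst y))"
      by (intro pi.integrable_const_bound[where B = b]) (use b in auto)
    then show ?thesis
      using integral_pi_fst[OF \<gamma> f_measurable] by (simp add: g_def pi.prob_space)
  qed
  obtain u H where u: "(\<lambda>(y, \<gamma>). u y \<gamma>) \<in> borel_measurable (state_space \<Otimes>\<^sub>M I)"
    and u_bound: "\<And>y \<gamma>. \<gamma> \<in> space I \<Longrightarrow> \<bar>u y \<gamma>\<bar> \<le> H"
    and poisson: "\<And>y \<gamma>. \<gamma> \<in> space I \<Longrightarrow> (\<integral>z. u z \<gamma> \<partial>P \<gamma> y) = u y \<gamma> - g y"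
    using poisson_equation[OF tau Lambda ergodic g g_bound c centred] by metis
  have \<Gamma>: "\<Gamma> i \<omega> \<in> space I" if "\<omega> \<in> space M" for i \<omega>
    using measurable_space[OF Gamma_measurable that] .
  \<comment> \<open>By the Poisson equation \<open>v y \<gamma>\<close> is the integral of
    \<open>u\<close> in its state argument against \<open>P \<gamma> y\<close>, that is, its
    one-step prediction.\<close>
  define v where "v = (\<lambda>y \<gamma>. u y \<gamma> - g y)"
  have v_bound: "\<bar>v y \<gamma>\<bar> \<le> H + c" if "\<gamma> \<in> space I" for y \<gamma>
    using u_bound[OF that, of y] g_bound[of y] by (simp add: v_def)
  \<comment> \<open>Both terms carry the parameter \<open>\<Gamma> i\<close>, because the step from
    \<open>i\<close> to \<open>Suc i\<close> uses the kernel with that parameter; this makes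
    \<open>D i\<close> a martingale difference.\<close>
  define D where "D = (\<lambda>i \<omega>. u (Y (Suc i) \<omega>) (\<Gamma> i \<omega>) - v (Y i \<omega>) (\<Gamma> i \<omega>))"
  have u_hist: "(\<lambda>\<omega>. u (Y i \<omega>) (\<Gamma> j \<omega>)) \<in> borel_measurable (history n)" if "i \<le> n" "j \<le> n" for i j n
    using measurable_compose[OF measurable_Pair[OF Y_measurable_history Gamma_measurable_history] u, OF that]
    by simp
  have v_hist: "(\<lambda>\<omega>. v (Y i \<omega>) (\<Gamma> j \<omega>)) \<in> borel_measurable (history n)" if "i \<le> n" "j \<le> n" for i j n
    unfolding v_def
    by (intro borel_measurable_diff u_hist that measurable_compose[OF Y_measurable_history g])
  have D_hist: "D i \<in> borel_measurable (history n)" if "i < n" for i n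
    unfolding D_def by (intro borel_measurable_diff u_hist v_hist) (use that in auto)
  have D_meas: "D i \<in> borel_measurable M" for i
    using measurable_from_subalg[OF subalgebra_history D_hist[of i "Suc i"]] by simp
  have D_bound: "\<bar>D i \<omega>\<bar> \<le> 2 * H + c" if "\<omega> \<in> space M" for i \<omega>
    using u_bound[OF \<Gamma>[OF that], of "Y (Suc i) \<omega>" i] v_bound[OF \<Gamma>[OF that], of "Y i \<omega>" i]
    by (simp add: D_def)
  \<comment> \<open>The bound on \<open>u\<close> needs a point of the parameter space; the chain
    supplies one, since the sample space is nonempty.\<close>
  have "H \<ge> 0"
    using u_bound[OF \<Gamma>] not_empty by (metis abs_ge_zero ex_in_conv order_trans)
  then have C: "2 * H + c > 0" using c by simp
  have orth: "expectation (\<lambda>\<omega>. exp (s * (\<Sum>i<n. D i \<omega>)) * D n \<omega>) = 0" for s n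
  proof -
    define W where "W = (\<lambda>\<omega>. exp (s * (\<Sum>i<n. D i \<omega>)))"
    \<comment> \<open>Here \<open>z\<close> stands for the next state and all other quantities are
      known at time \<open>n\<close>. Integrating \<open>z\<close> out turns the bracket into
      \<open>v - v = 0\<close>.\<close>
    define h where "h = (\<lambda>(\<omega>, z). W \<omega> * (u z (\<Gamma> n \<omega>) - v (Y n \<omega>) (\<Gamma> n \<omega>)))"
    have W: "W \<in> borel_measurable (history n)"
      unfolding W_def
      by (intro measurable_compose[OF _ borel_measurable_exp] borel_measurable_times borel_measurable_sum
          D_hist borel_measurable_const) auto
    have "(\<lambda>x. u (snd x) (\<Gamma> n (fst x))) \<in> borel_measurable (history n \<Otimes>\<^sub>M state_space)"
      using measurable_compose[OF measurable_Pair[OF measurable_snd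
            measurable_compose[OF measurable_fst Gamma_measurable_history[OF order_refl]]] u]
      by simp
    then have "h \<in> borel_measurable (history n \<Otimes>\<^sub>M state_space)"
      unfolding h_def case_prod_beta'
      by (intro borel_measurable_times borel_measurable_diff measurable_compose[OF measurable_fst W]
          measurable_compose[OF measurable_fst v_hist[OF order_refl order_refl]])
    moreover have "\<bar>h (\<omega>, z)\<bar> \<le> exp (\<bar>s\<bar> * (real n * (2 * H + c))) * (2 * H + c)"
      if \<omega>: "\<omega> \<in> space M" for \<omega> z
    proof -
      have "\<bar>\<Sum>i<n. D i \<omega>\<bar> \<le> real n * (2 * H + c)"
        using sum_bounded_above[of "{..<n}" "\<lambda>i. \<bar>D i \<omega>\<bar>" "2 * H + c"] D_bound[OF \<omega>]
        by (intro order.trans[OF sum_abs]) simp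
      then have "\<bar>s * (\<Sum>i<n. D i \<omega>)\<bar> \<le> \<bar>s\<bar> * (real n * (2 * H + c))"
        unfolding abs_mult by (rule mult_left_mono) simp
      then have "W \<omega> \<le> exp (\<bar>s\<bar> * (real n * (2 * H + c)))"
        unfolding W_def exp_le_cancel_iff by (rule abs_le_D1)
      moreover have "\<bar>u z (\<Gamma> n \<omega>) - v (Y n \<omega>) (\<Gamma> n \<omega>)\<bar> \<le> 2 * H + c"
        using u_bound[OF \<Gamma>[OF \<omega>], of z n] v_bound[OF \<Gamma>[OF \<omega>], of "Y n \<omega>" n] by linarith
      moreover have "\<bar>W \<omega>\<bar> = W \<omega>" by (simp add: W_def)
      ultimately show ?thesis
        unfolding h_def prod.case abs_mult by (intro mult_mono) auto
    qed
    ultimately have "(\<integral>\<omega>. h (\<omega>, Y (Suc n) \<omega>) \<partial>M) = (\<integral>\<omega>. (\<integral>z. h (\<omega>, z) \<partial>P (\<Gamma> n \<omega>) (Y n \<omega>)) \<partial>M)"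
      by (rule integral_transition)
    also have "\<dots> = (\<integral>\<omega>. 0 \<partial>M)"
    proof (rule Bochner_Integration.integral_cong[OF refl])
      fix \<omega> assume "\<omega> \<in> space M"
      note \<gamma> = \<Gamma>[OF this, of n]
      have K: "P (\<Gamma> n \<omega>) (Y n \<omega>) \<in> space (prob_algebra state_space)"
        using measurable_space[OF kernel[OF \<gamma>]] by (simp add: space_pair_measure)
      then have sets: "sets (P (\<Gamma> n \<omega>) (Y n \<omega>)) = sets state_space"
        by (simp add: space_prob_algebra)
      interpret K: prob_space "P (\<Gamma> n \<omega>) (Y n \<omega>)" using K by (simp add: space_prob_algebra)
      have "(\<lambda>z. u z (\<Gamma> n \<omega>)) \<in> borel_measurable (P (\<Gamma> n \<omega>) (Y n \<omega>))"
        using measurable_compose[OF measurable_Pair2'[OF \<gamma>] u] measurable_cong_sets[OF sets refl] by auto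
      then have "integrable (P (\<Gamma> n \<omega>) (Y n \<omega>)) (\<lambda>z. u z (\<Gamma> n \<omega>))"
        by (intro K.integrable_const_bound[where B = H]) (use u_bound[OF \<gamma>] in auto)
      then show "(\<integral>z. h (\<omega>, z) \<partial>P (\<Gamma> n \<omega>) (Y n \<omega>)) = 0"
        using poisson[OF \<gamma>] by (simp add: h_def K.prob_space v_def)
    qed
    finally show ?thesis
      by (simp add: h_def W_def D_def)
  qed
  have "AE \<omega> in M. (\<lambda>n. 1 / (sqrt (real n) * ln (real n) powr (1 / 2 + \<epsilon>)) * (\<Sum>i<n. D i \<omega>)) \<longlonglongrightarrow> 0"
    by (rule bounded_martingale_sum_growth[OF D_meas D_bound orth C eps])
  then show ?thesis
    using AE_space
  proof eventually_elim
    case (elim \<omega>)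
    define q where "q = (\<lambda>n. 1 / (sqrt (real n) * ln (real n) powr (1 / 2 + \<epsilon>)))"
    define r where "r = (\<lambda>n. \<Sum>i<n. v (Y i \<omega>) (\<Gamma> i \<omega>) - v (Y (Suc i) \<omega>) (\<Gamma> i \<omega>))"
    \<comment> \<open>With \<open>j = Suc i\<close>, the term \<open>g (Y j)\<close> equals
      \<open>u - v\<close> at state \<open>Y (Suc i)\<close> and parameter
      \<open>\<Gamma> i\<close>; adding and subtracting \<open>v (Y i) (\<Gamma> i)\<close>
      separates the martingale difference from the telescoping part.\<close>
    have split: "(\<Sum>j=1..n. f (fst (Y j \<omega>)) - (\<integral>x. f x \<partial>\<nu>)) = (\<Sum>i<n. D i \<omega>) + r n" for n
      by (simp add: sum.atLeast1_atMost_eq r_def D_def v_def g_def flip: sum.distrib)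
    \<comment> \<open>The factor \<open>sqrt n\<close> cancels, and what is left decays like
      \<open>(ln n) powr - (1 / 2 + \<epsilon>)\<close>.\<close>
    have majorant: "(\<lambda>n. q n * (2 * (H + c) * (1 + sqrt (2 * real n)))) \<longlonglongrightarrow> 0"
      unfolding q_def using eps by real_asymp
    have le: "norm (q n * r n) \<le> q n * (2 * (H + c) * (1 + sqrt (2 * real n)))" for n
    proof -
      \<comment> \<open>This includes \<open>n = 0\<close> and \<open>n = 1\<close>, where the
        normaliser is 0 and division by zero yields 0.\<close>
      have "0 \<le> q n" by (simp add: q_def)
      then show ?thesis
        using block_telescoping_bound[OF beta elim(2), where v = v and b = "H + c" and n = n, OF v_bound]
        unfolding r_def real_norm_def abs_mult by (intro mult_mono) auto
    qed
    have "(\<lambda>n. q n * r n) \<longlonglongrightarrow> 0"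
      by (rule Lim_null_comparison[OF _ majorant]) (rule always_eventually, rule allI, rule le)
    from tendsto_add[OF elim(1) this]
    show ?case
      unfolding split by (simp only: q_def distrib_left add_0)
  qed
qed

end
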